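(* In the duopoly model described in the context, for each of the two horizontal differentiations of the firms ('max' and 'min'), there is no additional total welfare from mandating XAI when $\beta t$ is small: there exists $\varepsilon>0$ such that for all $\beta,t>0$ with $\beta t<\varepsilon$, the maximal total welfare (over the policy-maker's choice $\xi\in[0,1]$) under mandatory XAI equals the maximal total welfare under optional XAI, i.e. $\Delta W_t=0$.
   Context: Model. Two firms $i=1,2$; parameters $\beta>0$ (quality cost) and $t>0$ (misfit cost). Customers $(x,\theta)$ are uniformly distributed on $[0,1]^2$. A customer buying from firm $i$ with quality $q_i\ge 0$, price $p_i\ge0$, XAI level $\xi_i\in[0,1]$ and location (XAI method) $e_i$ has utility $u_i=V+\theta q_i-p_i-t(1-\xi_i)|x-e_i|$, where the reservation value $V$ is large enough that every customer's utility is positive in equilibrium and every customer makes exactly one purchase, from the firm giving the higher utility. Firm 1 is the high-quality firm ($q_1\ge q_2$). Locations are exogenous: 'max' means $e_1=0,e_2=1$; 'min' means $e_1=e_2=1/2$. The demand $d_i$ is the area of the set of customers buying from $i$; profit is $\pi_i=p_id_i-\beta q_i^2$. Total welfare $W_t$ is the sum of both profits and the integral of customers' utilities. A market is quality-dominated (Q) if for every $x\in[0,1]$ there is an indifferent customer, and explanation-dominated (E) if for every $\theta\in[0,1]$ there is an indifferent customer. Under optional XAI the policy-maker chooses $\xi\in[0,1]$ and each firm chooses $\xi_i\in\{0,\xi\}$, then qualities, then prices. Under mandatory XAI the policy-maker chooses $\xi$ and $\xi_1=\xi_2=\xi$ is imposed; firms then choose qualities, then prices. The possible equilibria are: (Q2;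 'max' or 'min'; optional and mandatory) $\xi_1=\xi_2=\xi$, possible iff $\beta t\,\xi<4/9$: $p_1=\frac{4}{27\beta}$, $p_2=\frac{2}{27\beta}$, $q_1=\frac{2}{9\beta}$, $q_2=0$, $\pi_1=\frac{4}{81\beta}$, $\pi_2=\frac{2}{81\beta}$. (E2; 'max'; mandatory only) $\xi_1=\xi_2=\xi$, possible iff $\beta t>\frac{1}{6(2\xi^2-7\xi+6)}$: $p_1=p_2=t(1-\xi)$, $q_1=q_2=\frac1{12\beta}$, $\pi_1=\pi_2=\frac{t(1-\xi)}2-\frac1{144\beta}$. (E0; 'max'; optional only) $\xi_1=\xi_2=0$, possible iff $\beta t>\frac{1}{6(2\xi^2-7\xi+6)}$ and $\xi\le 1-\frac1{36\beta t}$: $p_1=p_2=t$, $q_1=q_2=\frac1{12\beta}$, $\pi_1=\pi_2=\frac t2-\frac1{144\beta}$. (E1; 'max'; optional only) $\xi_1=\xi,\ \xi_2=0$, possible iff $\beta t>\frac{1}{6(2\xi^2-7\xi+6)}$ and $\xi>1-\frac1{36\beta t}$. With $a=\beta t$, $N_1=36a-12a\xi-1$, $N_2=36a-24a\xi-1$, $D=36a-18a\xi-1$, $M=72a-36a\xi-1$: $p_i=\frac{t(2-\xi)N_i}{2D}$, $q_i=\frac{N_i}{12\beta D}$, $\pi_i=\frac{N_i^2M}{144\beta D^2}$. (E1; 'min'; optional only) $\xi_1=\xi,\ \xi_2=0$, possible iff $\beta t\,\xi>2/9$. With $\psi=\beta t\xi$: $p_1=\frac{t\xi(12\psi-1)}{4(9\psi-1)}$,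 $p_2=\frac{t\xi(6\psi-1)}{4(9\psi-1)}$, $q_1=\frac{12\psi-1}{12\beta(9\psi-1)}$, $q_2=\frac{6\psi-1}{12\beta(9\psi-1)}$, $\pi_1=\frac{(18\psi-1)(12\psi-1)^2}{144\beta(9\psi-1)^2}$, $\pi_2=\frac{(18\psi-1)(6\psi-1)^2}{144\beta(9\psi-1)^2}$. Market selection. If only one market (E or Q) is possible, it forms. If both are possible, each firm prefers the one giving it the higher profit; if the firms agree, that market forms, and if they disagree there is no Nash equilibrium (and the policy-maker must avoid such $\xi$). Under mandatory XAI, if profits in the resulting market are negative the firms leave and total welfare is $0$. $\Delta W_t$ denotes maximal $W_t$ under mandatory XAI minus maximal $W_t$ under optional XAI. *)

theory Defs
  imports "HOL-Analysis.Analysis"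
begin

datatype firm = Firm1 | Firm2

fun rival :: "firm \<Rightarrow> firm" where
  "rival Firm1 = Firm2"
| "rival Firm2 = Firm1"

datatype layout = Max_Diff | Min_Diff

fun location :: "layout \<Rightarrow> firm \<Rightarrow> real" where
  "location Max_Diff Firm1 = 0"
| "location Max_Diff Firm2 = 1"
| "location Min_Diff _ = 1 / 2"

datatype regime = Mandatory_XAI | Optional_XAI

record profile =
  xai :: "firm \<Rightarrow> real"
  price :: "firm \<Rightarrow> real"
  quality :: "firm \<Rightarrow> real"

text \<open>A customer is a pair \<open>(x, \<theta>)\<close>. Areas and integrals over the unit square are
  taken with respect to Lebesgue measure, that is, the uniform distribution of customers.\<close>

definition customers :: "(real \<times> real) set" where
  "customers = {0..1} \<times> {0..1}"

definition utility ::
  "layout \<Rightarrow> real \<Rightarrow> real \<Rightarrow> profile \<Rightarrow> firm \<Rightarrow> real \<times> real \<Rightarrow> real" where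
  "utility l t V s i = (\<lambda>(x, \<theta>).
     V + \<theta> * quality s i - price s i - t * (1 - xai s i) * \<bar>x - location l i\<bar>)"

definition buyers :: "layout \<Rightarrow> real \<Rightarrow> real \<Rightarrow> profile \<Rightarrow> firm \<Rightarrow> (real \<times> real) set" where
  "buyers l t V s i =
     {c \<in> customers. utility l t V s i c > utility l t V s (rival i) c}"

definition demand :: "layout \<Rightarrow> real \<Rightarrow> real \<Rightarrow> profile \<Rightarrow> firm \<Rightarrow> real" where
  "demand l t V s i = measure lborel (buyers l t V s i)"

definition profit :: "layout \<Rightarrow> real \<Rightarrow> real \<Rightarrow> real \<Rightarrow> profile \<Rightarrow> firm \<Rightarrow> real" where
  "profit l \<beta> t V s i = price s i * demand l t V s i - \<beta> * (quality s i)\<^sup>2"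

text \<open>Every customer buys once, from the firm giving the higher utility, and hence obtains
  the maximum of the two utilities.\<close>

definition purchase_utility :: "layout \<Rightarrow> real \<Rightarrow> real \<Rightarrow> profile \<Rightarrow> real \<times> real \<Rightarrow> real" where
  "purchase_utility l t V s c = max (utility l t V s Firm1 c) (utility l t V s Firm2 c)"

definition total_welfare :: "layout \<Rightarrow> real \<Rightarrow> real \<Rightarrow> real \<Rightarrow> profile \<Rightarrow> real" where
  "total_welfare l \<beta> t V s =
     profit l \<beta> t V s Firm1 + profit l \<beta> t V s Firm2
     + integral customers (purchase_utility l t V s)"

definition indifferent :: "layout \<Rightarrow> real \<Rightarrow> real \<Rightarrow> profile \<Rightarrow> real \<times> real \<Rightarrow> bool" where
  "indifferent l t V s c \<longleftrightarrow> utility l t V s Firm1 c = utility l t V s Firm2 c"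

definition quality_dominated :: "layout \<Rightarrow> real \<Rightarrow> real \<Rightarrow> profile \<Rightarrow> bool" where
  "quality_dominated l t V s \<longleftrightarrow> (\<forall>x\<in>{0..1}. \<exists>\<theta>\<in>{0..1}. indifferent l t V s (x, \<theta>))"

definition explanation_dominated :: "layout \<Rightarrow> real \<Rightarrow> real \<Rightarrow> profile \<Rightarrow> bool" where
  "explanation_dominated l t V s \<longleftrightarrow> (\<forall>\<theta>\<in>{0..1}. \<exists>x\<in>{0..1}. indifferent l t V s (x, \<theta>))"

text \<open>The letter names the type of market (quality- or explanation-dominated), the number
  says how many firms provide XAI. At most one of the three E-equilibria is possible for
  given data, so comparing equilibria amounts to comparing markets.\<close>

datatype equilibrium = Q2 | E2 | E0 | E1

definition per_firm :: "real \<Rightarrow> real \<Rightarrow> firm \<Rightarrow> real" where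
  "per_firm a b i = (case i of Firm1 \<Rightarrow> a | Firm2 \<Rightarrow> b)"

definition E_threshold :: "real \<Rightarrow> real" where
  "E_threshold \<xi> = 1 / (6 * (2 * \<xi>\<^sup>2 - 7 * \<xi> + 6))"

fun possible ::
  "regime \<Rightarrow> layout \<Rightarrow> real \<Rightarrow> real \<Rightarrow> real \<Rightarrow> equilibrium \<Rightarrow> bool" where
  "possible r l \<beta> t \<xi> Q2 \<longleftrightarrow> \<beta> * t * \<xi> < 4 / 9"
| "possible r l \<beta> t \<xi> E2 \<longleftrightarrow>
     r = Mandatory_XAI \<and> l = Max_Diff \<and> \<beta> * t > E_threshold \<xi>"
| "possible r l \<beta> t \<xi> E0 \<longleftrightarrow>
     r = Optional_XAI \<and> l = Max_Diff \<and> \<beta> * t > E_threshold \<xi> \<and> \<xi> \<le> 1 - 1 / (36 * \<beta> * t)"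
| "possible r l \<beta> t \<xi> E1 \<longleftrightarrow>
     r = Optional_XAI \<and>
     (case l of
        Max_Diff \<Rightarrow> \<beta> * t > E_threshold \<xi> \<and> \<xi> > 1 - 1 / (36 * \<beta> * t)
      | Min_Diff \<Rightarrow> \<beta> * t * \<xi> > 2 / 9)"

text \<open>The equilibrium profits are not tabulated: they are given by \<^const>\<open>profit\<close>.\<close>

fun outcome :: "layout \<Rightarrow> real \<Rightarrow> real \<Rightarrow> real \<Rightarrow> equilibrium \<Rightarrow> profile" where
  "outcome l \<beta> t \<xi> Q2 =
     \<lparr>xai = per_firm \<xi> \<xi>,
      price = per_firm (4 / (27 * \<beta>)) (2 / (27 * \<beta>)),
      quality = per_firm (2 / (9 * \<beta>)) 0\<rparr>"
| "outcome l \<beta> t \<xi> E2 =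
     \<lparr>xai = per_firm \<xi> \<xi>,
      price = per_firm (t * (1 - \<xi>)) (t * (1 - \<xi>)),
      quality = per_firm (1 / (12 * \<beta>)) (1 / (12 * \<beta>))\<rparr>"
| "outcome l \<beta> t \<xi> E0 =
     \<lparr>xai = per_firm 0 0,
      price = per_firm t t,
      quality = per_firm (1 / (12 * \<beta>)) (1 / (12 * \<beta>))\<rparr>"
| "outcome Max_Diff \<beta> t \<xi> E1 =
     (let a = \<beta> * t;
          N\<^sub>1 = 36 * a - 12 * a * \<xi> - 1;
          N\<^sub>2 = 36 * a - 24 * a * \<xi> - 1;
          D = 36 * a - 18 * a * \<xi> - 1
      in \<lparr>xai = per_firm \<xi> 0,
          price = per_firm (t * (2 - \<xi>) * N\<^sub>1 / (2 * D)) (t * (2 - \<xi>) * N\<^sub>2 / (2 * D)),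
          quality = per_firm (N\<^sub>1 / (12 * \<beta> * D)) (N\<^sub>2 / (12 * \<beta> * D))\<rparr>)"
| "outcome Min_Diff \<beta> t \<xi> E1 =
     (let \<psi> = \<beta> * t * \<xi>
      in \<lparr>xai = per_firm \<xi> 0,
          price = per_firm (t * \<xi> * (12 * \<psi> - 1) / (4 * (9 * \<psi> - 1)))
                           (t * \<xi> * (6 * \<psi> - 1) / (4 * (9 * \<psi> - 1))),
          quality = per_firm ((12 * \<psi> - 1) / (12 * \<beta> * (9 * \<psi> - 1)))
                             ((6 * \<psi> - 1) / (12 * \<beta> * (9 * \<psi> - 1)))\<rparr>)"

text \<open>If two markets are possible, one of them forms only when both firms prefer it;
  if the firms disagree, none does.\<close>

definition forms ::
  "regime \<Rightarrow> layout \<Rightarrow> real \<Rightarrow> real \<Rightarrow> real \<Rightarrow> real \<Rightarrow> equilibrium \<Rightarrow> bool" where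
  "forms r l \<beta> t V \<xi> k \<longleftrightarrow>
     possible r l \<beta> t \<xi> k \<and>
     (\<forall>k'. possible r l \<beta> t \<xi> k' \<longrightarrow>
        (\<forall>i. profit l \<beta> t V (outcome l \<beta> t \<xi> k') i \<le> profit l \<beta> t V (outcome l \<beta> t \<xi> k) i))"

definition firms_leave ::
  "regime \<Rightarrow> layout \<Rightarrow> real \<Rightarrow> real \<Rightarrow> real \<Rightarrow> profile \<Rightarrow> bool" where
  "firms_leave r l \<beta> t V s \<longleftrightarrow> r = Mandatory_XAI \<and> (\<exists>i. profit l \<beta> t V s i < 0)"

definition realized_welfare ::
  "regime \<Rightarrow> layout \<Rightarrow> real \<Rightarrow> real \<Rightarrow> real \<Rightarrow> profile \<Rightarrow> real" where
  "realized_welfare r l \<beta> t V s =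
     (if firms_leave r l \<beta> t V s then 0 else total_welfare l \<beta> t V s)"

definition attainable_welfare ::
  "regime \<Rightarrow> layout \<Rightarrow> real \<Rightarrow> real \<Rightarrow> real \<Rightarrow> real set" where
  "attainable_welfare r l \<beta> t V =
     {realized_welfare r l \<beta> t V (outcome l \<beta> t \<xi> k) | \<xi> k. \<xi> \<in> {0..1} \<and> forms r l \<beta> t V \<xi> k}"

text \<open>\<^const>\<open>Greatest\<close> is only meaningful if the maximum is attained.\<close>

definition has_max_welfare ::
  "regime \<Rightarrow> layout \<Rightarrow> real \<Rightarrow> real \<Rightarrow> real \<Rightarrow> bool" where
  "has_max_welfare r l \<beta> t V \<longleftrightarrow>
     (\<exists>w \<in> attainable_welfare r l \<beta> t V. \<forall>w' \<in> attainable_welfare r l \<beta> t V. w' \<le> w)"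

definition max_welfare :: "regime \<Rightarrow> layout \<Rightarrow> real \<Rightarrow> real \<Rightarrow> real \<Rightarrow> real" where
  "max_welfare r l \<beta> t V = (GREATEST w. w \<in> attainable_welfare r l \<beta> t V)"

definition delta_welfare :: "layout \<Rightarrow> real \<Rightarrow> real \<Rightarrow> real \<Rightarrow> real" where
  "delta_welfare l \<beta> t V =
     max_welfare Mandatory_XAI l \<beta> t V - max_welfare Optional_XAI l \<beta> t V"

definition reservation_large :: "layout \<Rightarrow> real \<Rightarrow> real \<Rightarrow> real \<Rightarrow> bool" where
  "reservation_large l \<beta> t V \<longleftrightarrow>
     (\<forall>r. \<forall>\<xi>\<in>{0..1}. \<forall>k. \<forall>c\<in>customers.
        forms r l \<beta> t V \<xi> k \<longrightarrow> \<not> firms_leave r l \<beta> t V (outcome l \<beta> t \<xi> k) \<longrightarrow>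
        purchase_utility l t V (outcome l \<beta> t \<xi> k) c > 0)"

text \<open>For \<open>\<beta> t (1 - \<xi>) \<le> 2/27\<close>, the Q-equilibrium is a quality-dominated
  market, with demands 2/3 and 1/3 and profits \<open>4 / (81 \<beta>)\<close> and \<open>2 / (81 \<beta>)\<close>.\<close>

lemma area_above_line:
  fixes c :: real
  assumes "\<bar>c\<bar> \<le> 1 / 3"
  shows "measure lborel {(x, \<theta>). x \<in> {0..1} \<and> \<theta> \<in> {0..1} \<and> 1 / 3 + c * (2 * x - 1) < \<theta>} = 2 / 3"
    (is "measure lborel ?A = _")
proof -
  have m: "?A \<in> sets borel"
  proof -
    have "?A = ({0..1} \<times> {0..1}) \<inter> {z. 1 / 3 + c * (2 * fst z - 1) < snd z}" by auto
    moreover have "open {z :: real \<times> real. 1 / 3 + c * (2 * fst z - 1) < snd z}"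
      by (intro open_Collect_less continuous_intros)
    moreover have "closed ({0..1::real} \<times> {0..1::real})"
      by (intro closed_Times) auto
    ultimately show ?thesis by simp
  qed
  have bnd: "0 \<le> 1 / 3 + c * (2 * x - 1)" "1 / 3 + c * (2 * x - 1) \<le> 2 / 3" if "x \<in> {0..1}" for x
  proof -
    have "\<bar>c * (2 * x - 1)\<bar> \<le> 1 / 3 * 1"
      unfolding abs_mult using that assms by (intro mult_mono) auto
    then show "0 \<le> 1 / 3 + c * (2 * x - 1)" "1 / 3 + c * (2 * x - 1) \<le> 2 / 3" by linarith+
  qed
  have "emeasure lborel ?A = (\<integral>\<^sup>+ x. emeasure lborel (Pair x -` ?A) \<partial>lborel)"
    using lborel.emeasure_pair_measure_alt [of ?A lborel] m unfolding lborel_prod by simp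
  also have "\<dots> = (\<integral>\<^sup>+ x. ennreal (2 / 3 - c * (2 * x - 1)) * indicator {0..1} x \<partial>lborel)"
  proof (rule nn_integral_cong)
    fix x :: real
    show "emeasure lborel (Pair x -` ?A) = ennreal (2 / 3 - c * (2 * x - 1)) * indicator {0..1} x"
    proof (cases "x \<in> {0..1}")
      case True
      then have "Pair x -` ?A = {1 / 3 + c * (2 * x - 1)<..1}" using bnd [OF True] by auto
      then show ?thesis using True bnd [OF True] by (simp add: algebra_simps)
    next
      case False
      then have e: "Pair x -` ?A = {}" by auto
      show ?thesis unfolding e using False by simp
    qed
  qed
  also have "\<dots> = ennreal ((2 / 3 * 1 - c * (1\<^sup>2 - 1)) - (2 / 3 * 0 - c * (0\<^sup>2 - 0)))"
  proof (rule nn_integral_FTC_Icc [where F = "\<lambda>x. 2 / 3 * x - c * (x\<^sup>2 - x)"])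
    fix x :: real
    assume x: "x \<in> {0..1}"
    show "((\<lambda>x. 2 / 3 * x - c * (x\<^sup>2 - x)) has_real_derivative 2 / 3 - c * (2 * x - 1)) (at x)"
      by (auto intro!: derivative_eq_intros)
    show "0 \<le> 2 / 3 - c * (2 * x - 1)" using bnd [OF x] by auto
  qed auto
  finally show ?thesis by (simp add: measure_def)
qed

lemma area_below_line:
  fixes c :: real
  assumes "\<bar>c\<bar> \<le> 1 / 3"
  shows "measure lborel {(x, \<theta>). x \<in> {0..1} \<and> \<theta> \<in> {0..1} \<and> \<theta> < 1 / 3 + c * (2 * x - 1)} = 1 / 3"
    (is "measure lborel ?A = _")
proof -
  have m: "?A \<in> sets borel"
  proof -
    have "?A = ({0..1} \<times> {0..1}) \<inter> {z. snd z < 1 / 3 + c * (2 * fst z - 1)}" by auto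
    moreover have "open {z :: real \<times> real. snd z < 1 / 3 + c * (2 * fst z - 1)}"
      by (intro open_Collect_less continuous_intros)
    moreover have "closed ({0..1::real} \<times> {0..1::real})"
      by (intro closed_Times) auto
    ultimately show ?thesis by simp
  qed
  have bnd: "0 \<le> 1 / 3 + c * (2 * x - 1)" "1 / 3 + c * (2 * x - 1) \<le> 2 / 3" if "x \<in> {0..1}" for x
  proof -
    have "\<bar>c * (2 * x - 1)\<bar> \<le> 1 / 3 * 1"
      unfolding abs_mult using that assms by (intro mult_mono) auto
    then show "0 \<le> 1 / 3 + c * (2 * x - 1)" "1 / 3 + c * (2 * x - 1) \<le> 2 / 3" by linarith+
  qed
  have "emeasure lborel ?A = (\<integral>\<^sup>+ x. emeasure lborel (Pair x -` ?A) \<partial>lborel)"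
    using lborel.emeasure_pair_measure_alt [of ?A lborel] m unfolding lborel_prod by simp
  also have "\<dots> = (\<integral>\<^sup>+ x. ennreal (1 / 3 + c * (2 * x - 1)) * indicator {0..1} x \<partial>lborel)"
  proof (rule nn_integral_cong)
    fix x :: real
    show "emeasure lborel (Pair x -` ?A) = ennreal (1 / 3 + c * (2 * x - 1)) * indicator {0..1} x"
    proof (cases "x \<in> {0..1}")
      case True
      then have "Pair x -` ?A = {0..<1 / 3 + c * (2 * x - 1)}" using bnd [OF True] by auto
      then show ?thesis using True bnd [OF True] by simp
    next
      case False
      then have e: "Pair x -` ?A = {}" by auto
      show ?thesis unfolding e using False by simp
    qed
  qed
  also have "\<dots> = ennreal ((1 / 3 * 1 + c * (1\<^sup>2 - 1)) - (1 / 3 * 0 + c * (0\<^sup>2 - 0)))"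
  proof (rule nn_integral_FTC_Icc [where F = "\<lambda>x. 1 / 3 * x + c * (x\<^sup>2 - x)"])
    fix x :: real
    assume x: "x \<in> {0..1}"
    show "((\<lambda>x. 1 / 3 * x + c * (x\<^sup>2 - x)) has_real_derivative 1 / 3 + c * (2 * x - 1)) (at x)"
      by (auto intro!: derivative_eq_intros)
    show "0 \<le> 1 / 3 + c * (2 * x - 1)" using bnd [OF x] by auto
  qed auto
  finally show ?thesis by (simp add: measure_def)
qed

definition Q2_slope :: "layout \<Rightarrow> real \<Rightarrow> real \<Rightarrow> real \<Rightarrow> real" where
  "Q2_slope l \<beta> t \<xi> = (case l of Max_Diff \<Rightarrow> 9 / 2 * (\<beta> * t * (1 - \<xi>)) | Min_Diff \<Rightarrow> 0)"

lemma Q2_utility_difference: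
  assumes "\<beta> > 0" "x \<in> {0..1}"
  shows "utility l t V (outcome l \<beta> t \<xi> Q2) Firm1 (x, \<theta>) - utility l t V (outcome l \<beta> t \<xi> Q2) Firm2 (x, \<theta>)
    = 2 / (9 * \<beta>) * (\<theta> - (1 / 3 + Q2_slope l \<beta> t \<xi> * (2 * x - 1)))"
  using assms by (cases l) (auto simp: utility_def per_firm_def Q2_slope_def field_simps)

context
  fixes \<beta> t \<xi> :: real and l :: layout
  assumes pos: "\<beta> > 0" "t > 0" and xi: "\<xi> \<in> {0..1}" and small: "\<beta> * t * (1 - \<xi>) \<le> 2 / 27"
begin

lemma Q2_slope_bound: "\<bar>Q2_slope l \<beta> t \<xi>\<bar> \<le> 1 / 3"
  using pos xi small by (cases l) (auto simp: Q2_slope_def abs_mult)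

lemma Q2_quality_dominated: "quality_dominated l t V (outcome l \<beta> t \<xi> Q2)"
  unfolding quality_dominated_def indifferent_def
proof
  fix x :: real
  assume x: "x \<in> {0..1}"
  let ?\<theta> = "1 / 3 + Q2_slope l \<beta> t \<xi> * (2 * x - 1)"
  have "\<bar>Q2_slope l \<beta> t \<xi> * (2 * x - 1)\<bar> \<le> 1 / 3 * 1"
    unfolding abs_mult using x Q2_slope_bound by (intro mult_mono) auto
  then have "0 \<le> ?\<theta>" "?\<theta> \<le> 1" by linarith+
  then have "?\<theta> \<in> {0..1}" by simp
  moreover have "utility l t V (outcome l \<beta> t \<xi> Q2) Firm1 (x, ?\<theta>) = utility l t V (outcome l \<beta> t \<xi> Q2) Firm2 (x, ?\<theta>)"
    using Q2_utility_difference [OF pos(1) x, of l t V \<xi> ?\<theta>] by simp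
  ultimately show "\<exists>\<theta>\<in>{0..1}. utility l t V (outcome l \<beta> t \<xi> Q2) Firm1 (x, \<theta>) = utility l t V (outcome l \<beta> t \<xi> Q2) Firm2 (x, \<theta>)"
    by blast
qed

lemma Q2_demand:
  "demand l t V (outcome l \<beta> t \<xi> Q2) Firm1 = 2 / 3"
  "demand l t V (outcome l \<beta> t \<xi> Q2) Firm2 = 1 / 3"
proof -
  let ?s = "outcome l \<beta> t \<xi> Q2"
  have iff: "utility l t V ?s Firm2 (x, \<theta>) < utility l t V ?s Firm1 (x, \<theta>) \<longleftrightarrow>
      1 / 3 + Q2_slope l \<beta> t \<xi> * (2 * x - 1) < \<theta>"
    "utility l t V ?s Firm1 (x, \<theta>) < utility l t V ?s Firm2 (x, \<theta>) \<longleftrightarrow>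
      \<theta> < 1 / 3 + Q2_slope l \<beta> t \<xi> * (2 * x - 1)" if x: "x \<in> {0..1}" for x \<theta>
  proof -
    define d where "d = \<theta> - (1 / 3 + Q2_slope l \<beta> t \<xi> * (2 * x - 1))"
    have e: "utility l t V ?s Firm1 (x, \<theta>) - utility l t V ?s Firm2 (x, \<theta>) = 2 / (9 * \<beta>) * d"
      unfolding d_def by (rule Q2_utility_difference [OF pos(1) x])
    have "0 < 2 / (9 * \<beta>) * d \<longleftrightarrow> 0 < d" "2 / (9 * \<beta>) * d < 0 \<longleftrightarrow> d < 0"
      using pos by (simp_all add: zero_less_mult_iff mult_less_0_iff zero_less_divide_iff divide_less_0_iff)
    then show "utility l t V ?s Firm2 (x, \<theta>) < utility l t V ?s Firm1 (x, \<theta>) \<longleftrightarrow>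
        1 / 3 + Q2_slope l \<beta> t \<xi> * (2 * x - 1) < \<theta>"
      "utility l t V ?s Firm1 (x, \<theta>) < utility l t V ?s Firm2 (x, \<theta>) \<longleftrightarrow>
        \<theta> < 1 / 3 + Q2_slope l \<beta> t \<xi> * (2 * x - 1)"
      using e unfolding d_def by linarith+
  qed
  have "buyers l t V ?s Firm1 = {(x, \<theta>). x \<in> {0..1} \<and> \<theta> \<in> {0..1} \<and> 1 / 3 + Q2_slope l \<beta> t \<xi> * (2 * x - 1) < \<theta>}"
    unfolding buyers_def customers_def rival.simps using iff(1) by blast
  then show "demand l t V ?s Firm1 = 2 / 3"
    unfolding demand_def by (metis area_above_line [OF Q2_slope_bound])
  have "buyers l t V ?s Firm2 = {(x, \<theta>). x \<in> {0..1} \<and> \<theta> \<in> {0..1} \<and> \<theta> < 1 / 3 + Q2_slope l \<beta> t \<xi> * (2 * x - 1)}"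
    unfolding buyers_def customers_def rival.simps using iff(2) by blast
  then show "demand l t V ?s Firm2 = 1 / 3"
    unfolding demand_def by (metis area_below_line [OF Q2_slope_bound])
qed

lemma Q2_profit:
  "profit l \<beta> t V (outcome l \<beta> t \<xi> Q2) Firm1 = 4 / (81 * \<beta>)"
  "profit l \<beta> t V (outcome l \<beta> t \<xi> Q2) Firm2 = 2 / (81 * \<beta>)"
  unfolding profit_def Q2_demand using pos
  by (simp_all add: per_firm_def power2_eq_square field_simps)

end

lemma E_explanation_dominated:
  "explanation_dominated Max_Diff t V (outcome Max_Diff \<beta> t \<xi> E2)"
  "explanation_dominated Max_Diff t V (outcome Max_Diff \<beta> t \<xi> E0)"
  unfolding explanation_dominated_def
  by (auto intro!: bexI [of _ "1 / 2"] simp: indifferent_def utility_def per_firm_def)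

end

theory Submission
  imports Defs
begin

text \<open>For \<open>\<beta> t < 1/36\<close> the thresholds exclude every equilibrium except Q2, which is possible for
  every \<open>\<xi>\<close>, so both regimes attain the same welfare levels. The Q2 prices, qualities and demands do not
  depend on \<open>\<xi>\<close>, while a larger \<open>\<xi>\<close> lowers every customer's misfit cost; hence \<open>\<xi> = 1\<close> is optimal.\<close>

text \<open>The quadratic in the denominator factors as (2 - \<xi>) * (3 - 2 * \<xi>), whose
  positive factors are largest at \<xi> = 0, with product 6. This is the source of the constant 1/36
  chosen for \<epsilon>.\<close>

lemma E_threshold_ge:
  assumes "\<xi> \<in> {0..1}"
  shows "E_threshold \<xi> \<ge> 1 / 36"
proof -
  have eq: "2 * \<xi>\<^sup>2 - 7 * \<xi> + 6 = (2 - \<xi>) * (3 - 2 * \<xi>)"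
    by (simp add: power2_eq_square algebra_simps)
  have pos: "(2 - \<xi>) * (3 - 2 * \<xi>) > 0"
    using assms by (intro mult_pos_pos) auto
  have "(2 - \<xi>) * (3 - 2 * \<xi>) \<le> 2 * 3"
    using assms by (intro mult_mono) auto
  then show ?thesis
    unfolding E_threshold_def eq using pos by (simp add: field_simps)
qed

lemma possible_iff_Q2:
  assumes "\<beta> > 0" "t > 0" "\<beta> * t < 1 / 36" "\<xi> \<in> {0..1}"
  shows "possible r l \<beta> t \<xi> k \<longleftrightarrow> k = Q2"
proof -
  have "\<beta> * t * \<xi> \<le> \<beta> * t * 1"
    using assms by (intro mult_left_mono) auto
  \<comment> \<open>The bound 2/9 serves twice: it lies below the limit 4/9 for \<open>Q2\<close>,
    and it excludes \<open>E1\<close> under \<open>Min_Diff\<close>.\<close>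
  then have "\<beta> * t * \<xi> < 2 / 9"
    using assms(3) by linarith
  moreover have "\<not> \<beta> * t > E_threshold \<xi>"
    using E_threshold_ge [OF assms(4)] assms(3) by simp
  ultimately show ?thesis
    by (cases k; cases l) auto
qed

lemma forms_iff_Q2:
  assumes "\<beta> > 0" "t > 0" "\<beta> * t < 1 / 36" "\<xi> \<in> {0..1}"
  shows "forms r l \<beta> t V \<xi> k \<longleftrightarrow> k = Q2"
  unfolding forms_def possible_iff_Q2 [OF assms] by auto

text \<open>This is the condition of \<open>Q2_profit\<close>: it keeps the indifference line inside
  the unit square, so that the demands are 2/3 and 1/3.\<close>

lemma small_misfit:
  fixes \<beta> t \<xi> :: real
  assumes "\<beta> > 0" "t > 0" "\<beta> * t < 1 / 36" "\<xi> \<in> {0..1}"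
  shows "\<beta> * t * (1 - \<xi>) \<le> 2 / 27"
proof -
  have "\<beta> * t * (1 - \<xi>) \<le> \<beta> * t * 1"
    using assms by (intro mult_left_mono) auto
  then show ?thesis
    using assms(3) by linarith
qed

lemma not_firms_leave_Q2:
  assumes "\<beta> > 0" "t > 0" "\<beta> * t < 1 / 36" "\<xi> \<in> {0..1}"
  shows "\<not> firms_leave r l \<beta> t V (outcome l \<beta> t \<xi> Q2)"
proof -
  have "profit l \<beta> t V (outcome l \<beta> t \<xi> Q2) i \<ge> 0" for i
    using Q2_profit [OF assms(1,2,4) small_misfit [OF assms]] assms(1) by (cases i) simp_all
  then show ?thesis
    unfolding firms_leave_def by (simp add: not_less)
qed

text \<open>The regime enters only through \<open>possible\<close> and \<open>firms_leave\<close>,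
  and neither depends on it here, so \<open>r\<close> disappears from the right-hand side.\<close>

lemma attainable_welfare_eq:
  assumes "\<beta> > 0" "t > 0" "\<beta> * t < 1 / 36"
  shows "attainable_welfare r l \<beta> t V = (\<lambda>\<xi>. total_welfare l \<beta> t V (outcome l \<beta> t \<xi> Q2)) ` {0..1}"
  unfolding attainable_welfare_def realized_welfare_def
  using forms_iff_Q2 [OF assms] not_firms_leave_Q2 [OF assms]
  by (fastforce simp del: outcome.simps)

text \<open>Comparing two values of \<open>integral\<close> requires integrability; here a maximum
  of two continuous functions is integrated over a compact square.\<close>

lemma purchase_utility_integrable: "purchase_utility l t V s integrable_on customers"
proof -
  have "continuous_on (cbox (0, 0) (1, 1)) (purchase_utility l t V s)"
    unfolding purchase_utility_def [abs_def] utility_def case_prod_unfold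
    by (intro continuous_intros)
  moreover have "customers = cbox (0, 0) (1, 1)"
    by (simp add: customers_def cbox_Pair_eq)
  ultimately show ?thesis
    by (metis integrable_continuous)
qed

lemma purchase_utility_Q2_mono:
  assumes "t > 0" "\<xi> \<le> 1"
  shows "purchase_utility l t V (outcome l \<beta> t \<xi> Q2) c \<le> purchase_utility l t V (outcome l \<beta> t 1 Q2) c"
proof -
  have "utility l t V (outcome l \<beta> t \<xi> Q2) i c \<le> utility l t V (outcome l \<beta> t 1 Q2) i c" for i
    using assms by (cases i) (auto simp: utility_def per_firm_def split: prod.split)
  then show ?thesis
    unfolding purchase_utility_def by (intro max.mono)
qed

lemma total_welfare_Q2_le:
  assumes "\<beta> > 0" "t > 0" "\<beta> * t < 1 / 36" "\<xi> \<in> {0..1}"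
  shows "total_welfare l \<beta> t V (outcome l \<beta> t \<xi> Q2) \<le> total_welfare l \<beta> t V (outcome l \<beta> t 1 Q2)"
proof -
  have one: "(1::real) \<in> {0..1}" by simp
  have "integral customers (purchase_utility l t V (outcome l \<beta> t \<xi> Q2))
      \<le> integral customers (purchase_utility l t V (outcome l \<beta> t 1 Q2))"
    using assms by (intro integral_le purchase_utility_integrable purchase_utility_Q2_mono) auto
  \<comment> \<open>Both profits have the same values at \<xi> and at 1, so they cancel and only the
    customers' integrals remain.\<close>
  then show ?thesis
    unfolding total_welfare_def
    by (simp only: Q2_profit [OF assms(1,2,4) small_misfit [OF assms]]
        Q2_profit [OF assms(1,2) one small_misfit [OF assms(1-3) one]] add_le_cancel_left)
qed

theorem proposition5:
  fixes l :: layout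
  shows "\<exists>\<epsilon>>0. \<forall>\<beta> t V :: real.
           \<beta> > 0 \<longrightarrow> t > 0 \<longrightarrow> \<beta> * t < \<epsilon> \<longrightarrow> reservation_large l \<beta> t V \<longrightarrow>
             has_max_welfare Mandatory_XAI l \<beta> t V \<and>
             has_max_welfare Optional_XAI l \<beta> t V \<and>
             delta_welfare l \<beta> t V = 0"
proof (intro exI [of _ "1 / 36"] conjI allI impI)
  fix \<beta> t V :: real
  assume small: "\<beta> > 0" "t > 0" "\<beta> * t < 1 / 36"
  have max: "has_max_welfare r l \<beta> t V" for r
    unfolding has_max_welfare_def attainable_welfare_eq [OF small]
    \<comment> \<open>The witness is the welfare at \<xi> = 1.\<close>
    using total_welfare_Q2_le [OF small] by (intro bexI [OF _ imageI [of 1]]) auto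
  show "has_max_welfare Mandatory_XAI l \<beta> t V" "has_max_welfare Optional_XAI l \<beta> t V"
    by (rule max)+
  \<comment> \<open>Both maxima are taken over the same set, so the difference vanishes without
    computing either.\<close>
  show "delta_welfare l \<beta> t V = 0"
    unfolding delta_welfare_def max_welfare_def attainable_welfare_eq [OF small] by simp
qed simp

end
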